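(* Let $n\ge 4$. Then the quadratic rigidity property does not hold in $\mathbb{R}^n$; that is, for $\phi(t)=ct^2$ with any constant $c>0$, the $\phi$-rigidity property fails in $\mathbb{R}^n$.
   Context: Points of $\mathbb{R}^n$ are written $x=(x_1,\dots,x_n)$. Let $\phi:[0,+\infty)\to[0,+\infty)$ be a convex function such that $\phi(t)=0$ if and only if $t=0$. We say that the $\phi$-rigidity property holds in $\mathbb{R}^n$ if, for any vector field $\eta=(\eta_1,\dots,\eta_n)\in L^\infty(\mathbb{R}^n;\mathbb{R}^n)$ such that (i) $\eta=0$ (almost everywhere) on $\{x\in\mathbb{R}^n: x_n<0\}$; (ii) $\operatorname{div}\eta=0$ on $\mathbb{R}^n$ in the distributional sense; (iii) $\eta_n\ge\phi(|\eta|)$ almost everywhere on $\mathbb{R}^n$; one has $\eta=0$ almost everywhere on $\mathbb{R}^n$. Quadratic rigidity is the $\phi$-rigidity property for $\phi(t)=ct^2$, $c>0$. *)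

theory Defs
  imports "HOL-Analysis.Analysis"
begin

text \<open>
  R^n is \<open>real ^ 'n\<close> with a linearly ordered finite index type \<open>'n\<close>, n = \<open>CARD('n)\<close>.
  The coordinates x_1, ..., x_n are those of \<open>'n\<close> in increasing order, so the coordinate x_n
  belongs to the greatest index.
\<close>

definition last_index :: "'n::{finite,linorder}" where
  "last_index = Max UNIV"

definition partial_deriv :: "'n::finite \<Rightarrow> (real ^ 'n \<Rightarrow> real) \<Rightarrow> real ^ 'n \<Rightarrow> real" where
  "partial_deriv i f x = frechet_derivative f (at x) (axis i 1)"

text \<open>The class C^k: differentiability is required at every level, so \<^const>\<open>frechet_derivative\<close>
  is only used where it is meaningful.\<close>

fun Ck :: "nat \<Rightarrow> (real ^ 'n::finite \<Rightarrow> real) \<Rightarrow> bool" where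
  "Ck 0 f \<longleftrightarrow> continuous_on UNIV f"
| "Ck (Suc k) f \<longleftrightarrow> (\<forall>x. f differentiable (at x)) \<and> (\<forall>i. Ck k (partial_deriv i f))"

definition test_function :: "(real ^ 'n::finite \<Rightarrow> real) \<Rightarrow> bool" where
  "test_function \<psi> \<longleftrightarrow> (\<forall>k. Ck k \<psi>) \<and> compact (closure {x. \<psi> x \<noteq> 0})"

definition L_infinity :: "(real ^ 'n::finite \<Rightarrow> real ^ 'n) \<Rightarrow> bool" where
  "L_infinity \<eta> \<longleftrightarrow>
     \<eta> \<in> borel_measurable lebesgue \<and> (\<exists>C. AE x in lebesgue. norm (\<eta> x) \<le> C)"

text \<open>The pairing with grad \<open>\<psi>\<close> is required to be integrable, which is automatic for
  fields in \<^const>\<open>L_infinity\<close>.\<close>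

definition distributional_div_zero :: "(real ^ 'n::finite \<Rightarrow> real ^ 'n) \<Rightarrow> bool" where
  "distributional_div_zero \<eta> \<longleftrightarrow>
     (\<forall>\<psi>. test_function \<psi> \<longrightarrow>
        has_bochner_integral lebesgue (\<lambda>x. \<Sum>i\<in>UNIV. \<eta> x $ i * partial_deriv i \<psi> x) 0)"

text \<open>The standing assumptions on \<open>\<phi>\<close>; only its values on \<open>{0..}\<close> matter.\<close>

definition rigidity_profile :: "(real \<Rightarrow> real) \<Rightarrow> bool" where
  "rigidity_profile \<phi> \<longleftrightarrow>
     convex_on {0..} \<phi> \<and> (\<forall>t\<ge>0. \<phi> t \<ge> 0) \<and> (\<forall>t\<ge>0. \<phi> t = 0 \<longleftrightarrow> t = 0)"

definition phi_rigidity :: "'n::{finite,linorder} itself \<Rightarrow> (real \<Rightarrow> real) \<Rightarrow> bool" where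
  "phi_rigidity _ \<phi> \<longleftrightarrow>
     (\<forall>\<eta> :: real ^ 'n::{finite,linorder} \<Rightarrow> real ^ 'n::{finite,linorder}.
        L_infinity \<eta> \<longrightarrow>
        (AE x in lebesgue. x $ last_index < 0 \<longrightarrow> \<eta> x = 0) \<longrightarrow>
        distributional_div_zero \<eta> \<longrightarrow>
        (AE x in lebesgue. \<eta> x $ last_index \<ge> \<phi> (norm (\<eta> x))) \<longrightarrow>
        (AE x in lebesgue. \<eta> x = 0))"

text \<open>\<^const>\<open>phi_rigidity\<close> does not include \<^const>\<open>rigidity_profile\<close>; quadratic profiles satisfy it:\<close>

lemma rigidity_profile_quadratic:
  assumes "c > 0"
  shows "rigidity_profile (\<lambda>t. c * t\<^sup>2)"
proof -
  have "convex_on {0..} (\<lambda>t::real. c * t\<^sup>2)"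
    using assms convex_on_subset[OF convex_power2]
    by (intro convex_on_cmul) auto
  then show ?thesis
    using assms by (auto simp: rigidity_profile_def)
qed

end

theory Submission
  imports Defs
begin

text \<open>
  Write \<open>x = (y, t)\<close> with \<open>y\<close> in \<open>R^m\<close>, \<open>m = n - 1\<close>, and separate variables:
  \<open>\<eta> = \<epsilon> (- g'(t) A(y), g(t) div A(y))\<close> is divergence free for all \<open>g\<close> and \<open>A\<close>.
  If \<open>g'\<^sup>2 \<le> 4 g\<close> and \<open>|A|\<^sup>2 \<le> div A\<close>, then \<open>|\<eta>|\<^sup>2\<close> is at most a constant times \<open>\<epsilon> \<eta>_n\<close>, and
  a small \<open>\<epsilon>\<close> yields the quadratic bound. The function \<open>g(t) = t\<^sup>2 / (1 + t\<^sup>2)\<close> for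
  \<open>t > 0\<close>, extended by zero, has the first property. The field \<open>A(y) = y / (1 + |y|\<^sup>2)\<close> has the
  second one as soon as \<open>m \<ge> 3\<close>, because \<open>div A \<ge> (m - 2) / (1 + |y|\<^sup>2)\<close>.
\<close>

section \<open>Integrals of directional derivatives\<close>

text \<open>Translation invariance makes the integral of every difference quotient of
  \<open>f\<close> vanish, and dominated convergence carries this over to \<open>F\<close>. Only the
  derivative along \<open>e\<close> is asked for, because the components of the field constructed
  below need not be differentiable in other directions.\<close>

lemma has_bochner_integral_directional_derivative_zero:
  fixes f F :: "'a::euclidean_space \<Rightarrow> real" and e :: 'a
  assumes contf: "continuous_on UNIV f" and contF: "continuous_on UNIV F"
    and deriv: "\<And>x. ((\<lambda>s. f (x + s *\<^sub>R e)) has_real_derivative F x) (at 0)"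
    and supp: "\<And>x. norm x > R \<Longrightarrow> f x = 0"
  shows "has_bochner_integral lborel F 0"
proof -
  have derivs: "((\<lambda>s. f (x + s *\<^sub>R e)) has_real_derivative F (x + s *\<^sub>R e)) (at s)" for x s
    using deriv[of "x + s *\<^sub>R e"] DERIV_shift[of "\<lambda>s. f (x + s *\<^sub>R e)" "F (x + s *\<^sub>R e)" 0 s]
    by (simp add: algebra_simps)
  have Fsupp: "F x = 0" if "norm x > R" for x
  proof -
    have "open {s. norm (x + s *\<^sub>R e) > R}"
      by (intro open_Collect_less continuous_intros)
    then have "((\<lambda>s. 0) has_real_derivative F x) (at 0)"
      using that supp
      by (intro has_field_derivative_transform_within_open[OF deriv[of x]]) auto
    then show ?thesis
      using DERIV_unique DERIV_const by blast
  qed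
  have "compact (F ` cball 0 R)"
    by (intro compact_continuous_image continuous_on_subset[OF contF]) auto
  then obtain B where B: "\<And>x. x \<in> cball 0 R \<Longrightarrow> norm (F x) \<le> B"
    by (force simp: bounded_iff dest: compact_imp_bounded)
  \<comment> \<open>For \<open>R < 0\<close> the ball is empty and \<open>B\<close> may be negative,
    hence the absolute value.\<close>
  have Fbound: "\<bar>F x\<bar> \<le> \<bar>B\<bar>" for x
    using B[of x] Fsupp[of x] by (cases "norm x > R") auto
  \<comment> \<open>Steps of length at most 1 keep the supports of all quotients \<open>Q k\<close>
    inside one ball, of radius \<open>R + norm e\<close>.\<close>
  define h :: "nat \<Rightarrow> real" where "h = (\<lambda>k. 1 / (real k + 1))"
  have hpos: "h k > 0" "h k \<le> 1" for k
    by (auto simp: h_def)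
  define Q where "Q = (\<lambda>k x. (f (x + h k *\<^sub>R e) - f x) / h k)"
  define w :: "'a \<Rightarrow> real" where "w = (\<lambda>x. \<bar>B\<bar> * indicator (cball 0 (R + norm e)) x)"
  have mf: "f \<in> borel_measurable lborel" and mF: "F \<in> borel_measurable lborel"
    using contf contF by (auto intro: borel_measurable_continuous_onI)
  \<comment> \<open>By the mean value theorem \<open>Q k x\<close> is a value of \<open>F\<close> at
    a point within distance \<open>norm e\<close> of \<open>x\<close>.\<close>
  have Qbound: "norm (Q k x) \<le> w x" for k x
  proof -
    obtain z where z: "z > 0" "z < h k"
      "f (x + h k *\<^sub>R e) - f (x + 0 *\<^sub>R e) = (h k - 0) * F (x + z *\<^sub>R e)"
      using MVT2[of 0 "h k" "\<lambda>s. f (x + s *\<^sub>R e)" "\<lambda>s. F (x + s *\<^sub>R e)"] derivs hpos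
      by blast
    then have Q: "Q k x = F (x + z *\<^sub>R e)"
      using hpos[of k] by (simp add: Q_def)
    have "norm (z *\<^sub>R e) \<le> norm e"
      using z hpos[of k] by (simp add: mult_left_le_one_le)
    moreover have "norm x - norm (z *\<^sub>R e) \<le> norm (x + z *\<^sub>R e)"
      by (rule norm_diff_ineq)
    ultimately have "F (x + z *\<^sub>R e) = 0" if "norm x > R + norm e"
      using that by (intro Fsupp) linarith
    then show ?thesis
      using Fbound by (auto simp: Q w_def indicator_def)
  qed
  have lim: "(\<lambda>k. Q k x) \<longlonglongrightarrow> F x" for x
  proof -
    have "((\<lambda>s. (f (x + s *\<^sub>R e) - f x) / s) \<longlongrightarrow> F x) (at 0)"
      using deriv[of x] by (simp add: has_field_derivative_iff)
    moreover have "filterlim h (at 0) sequentially"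
      unfolding filterlim_at using LIMSEQ_inverse_real_of_nat hpos
      by (auto simp: h_def inverse_eq_divide add.commute)
    ultimately show ?thesis
      unfolding Q_def by (rule filterlim_compose)
  qed
  have wint: "integrable lborel w"
    unfolding w_def
    by (intro integrable_mult_right integrable_real_indicator emeasure_bounded_finite) auto
  have mQ: "Q k \<in> borel_measurable lborel" for k
    unfolding Q_def using mf by measurable
  have dom: "integrable lborel F" "(\<lambda>k. integral\<^sup>L lborel (Q k)) \<longlonglongrightarrow> integral\<^sup>L lborel F"
    using lim Qbound
    by (auto intro!: mF mQ wint integrable_dominated_convergence[where s = Q and w = w]
        integral_dominated_convergence[where w = w])
  have fint: "integrable lborel f"
  proof -
    have "f x = indicator (cball 0 R) x *\<^sub>R f x" for x
      using supp[of x] by (auto simp: indicator_def)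
    moreover have "integrable lborel (\<lambda>x. indicator (cball 0 R) x *\<^sub>R f x)"
      using borel_integrable_compact[of "cball 0 R" f] contf continuous_on_subset
      by (fastforce simp: set_integrable_def)
    ultimately show ?thesis
      by presburger
  qed
  have "integral\<^sup>L lborel (Q k) = 0" for k
  proof -
    have "has_bochner_integral lborel (\<lambda>x. f (h k *\<^sub>R e + x)) (integral\<^sup>L lborel f)"
      using fint mf integrable_distr_eq[of "(+) (h k *\<^sub>R e)" lborel borel f]
        integral_distr[of "(+) (h k *\<^sub>R e)" lborel borel f]
      by (simp add: has_bochner_integral_iff lborel_distr_plus)
    then show ?thesis
      using fint by (simp add: Q_def has_bochner_integral_iff add.commute)
  qed
  with dom(2) have "integral\<^sup>L lborel F = 0"
    by (simp add: LIMSEQ_const_iff)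
  with dom(1) show ?thesis
    by (simp add: has_bochner_integral_iff)
qed

section \<open>The profile in the last coordinate\<close>

definition ramp :: "real \<Rightarrow> real" where
  "ramp t = (if t \<le> 0 then 0 else t\<^sup>2 / (1 + t\<^sup>2))"

definition ramp' :: "real \<Rightarrow> real" where
  "ramp' t = (if t \<le> 0 then 0 else 2 * t / (1 + t\<^sup>2)\<^sup>2)"

lemma one_plus_square_neq_0 [simp]: "1 + (t::real)\<^sup>2 \<noteq> 0"
  by (metis add_pos_nonneg less_irrefl zero_le_power2 zero_less_one)

lemma has_real_derivative_ramp: "(ramp has_real_derivative ramp' t) (at t)"
proof -
  consider "t < 0" | "t > 0" | "t = 0" by linarith
  then show ?thesis
  proof cases
    case 1
    have "((\<lambda>_. 0) has_real_derivative ramp' t) (at t)"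
      using 1 by (simp add: ramp'_def)
    then show ?thesis
      by (rule has_field_derivative_transform_within_open[where S = "{..<0}"])
        (use 1 in \<open>auto simp: ramp_def\<close>)
  next
    case 2
    have "((\<lambda>t. t\<^sup>2 / (1 + t\<^sup>2)) has_real_derivative ramp' t) (at t)"
      using 2 by (auto intro!: derivative_eq_intros simp: ramp'_def)
        (simp add: power2_eq_square algebra_simps)
    then show ?thesis
      by (rule has_field_derivative_transform_within_open[where S = "{0<..}"])
        (use 2 in \<open>auto simp: ramp_def\<close>)
  next
    case 3
    \<comment> \<open>At the gluing point the difference quotient is 0 from the left and
      \<open>h / (1 + h\<^sup>2)\<close> from the right.\<close>
    have "norm (ramp h / h) \<le> \<bar>h\<bar>" for h
    proof (cases "h > 0")
      case True
      then have "ramp h / h = h / (1 + h\<^sup>2)"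
        by (simp add: ramp_def power2_eq_square)
      with True show ?thesis
        by (simp add: pos_divide_le_eq add_pos_nonneg mult_le_cancel_left1)
    qed (simp add: ramp_def)
    then have "((\<lambda>h. ramp h / h) \<longlongrightarrow> 0) (at 0)"
      by (intro Lim_null_comparison[OF _ tendsto_rabs_zero[OF tendsto_ident_at]]) auto
    then show ?thesis
      by (simp add: has_field_derivative_iff 3 ramp_def ramp'_def)
  qed
qed

lemma continuous_on_ramp: "continuous_on UNIV ramp"
  using has_real_derivative_ramp DERIV_isCont continuous_at_imp_continuous_on by blast

lemma continuous_on_ramp': "continuous_on UNIV ramp'"
proof -
  have "ramp' = (\<lambda>t. 2 * max 0 t / (1 + (max 0 t)\<^sup>2)\<^sup>2)"
    by (auto simp: ramp'_def max_def fun_eq_iff)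
  moreover have "continuous_on UNIV (\<lambda>t::real. 2 * max 0 t / (1 + (max 0 t)\<^sup>2)\<^sup>2)"
    by (intro continuous_intros) auto
  ultimately show ?thesis
    by (simp only:)
qed

lemma ramp_bounds: "0 \<le> ramp t" "ramp t \<le> 1"
  by (auto simp: ramp_def divide_simps add_pos_nonneg)

lemma ramp_pos: "t > 0 \<Longrightarrow> ramp t > 0"
  by (auto simp: ramp_def intro!: divide_pos_pos add_pos_nonneg)

lemma ramp'_square_le: "(ramp' t)\<^sup>2 \<le> 4 * ramp t"
proof (cases "t > 0")
  case True
  have "(ramp' t)\<^sup>2 = 4 * t\<^sup>2 / (1 + t\<^sup>2) ^ 4"
    using True by (simp add: ramp'_def power_divide power_mult_distrib flip: power_mult)
  \<comment> \<open>Three of the four factors in the denominator are dropped; each is at least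
    1.\<close>
  also have "\<dots> \<le> 4 * t\<^sup>2 / (1 + t\<^sup>2) ^ 1"
    by (intro divide_left_mono power_increasing mult_pos_pos zero_less_power add_pos_nonneg) auto
  finally show ?thesis
    using True by (simp add: ramp_def)
qed (simp add: ramp_def ramp'_def)

section \<open>The field, its partial derivatives and its quadratic bound\<close>

definition hsq :: "real ^ 'n::{finite,linorder} \<Rightarrow> real" where
  "hsq x = (\<Sum>j\<in>UNIV - {last_index}. (x $ j)\<^sup>2)"

text \<open>This is div A for A(y) = y / (1 + |y|^2) in dimension n - 1, with |y|^2 =
  \<open>hsq x\<close>.\<close>

definition hdiv :: "real ^ 'n::{finite,linorder} \<Rightarrow> real" where
  "hdiv x = (real CARD('n) - 1) / (1 + hsq x) - 2 * hsq x / (1 + hsq x)\<^sup>2"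

definition counterexample_field ::
    "real \<Rightarrow> real ^ 'n::{finite,linorder} \<Rightarrow> real ^ 'n::{finite,linorder}" where
  "counterexample_field \<epsilon> x = (\<chi> i. \<epsilon> *
     (if i = last_index then ramp (x $ last_index) * hdiv x
      else - ramp' (x $ last_index) * x $ i / (1 + hsq x)))"

text \<open>The diagonal entries of the Jacobian matrix, the only ones that enter the
  divergence.\<close>

definition counterexample_partial ::
    "real \<Rightarrow> 'n::{finite,linorder} \<Rightarrow> real ^ 'n::{finite,linorder} \<Rightarrow> real" where
  "counterexample_partial \<epsilon> i x = \<epsilon> *
     (if i = last_index then ramp' (x $ last_index) * hdiv x
      else - ramp' (x $ last_index) * (1 / (1 + hsq x) - 2 * (x $ i)\<^sup>2 / (1 + hsq x)\<^sup>2))"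

lemma hsq_nonneg [simp]: "0 \<le> hsq x"
  by (simp add: hsq_def sum_nonneg)

lemma one_plus_hsq_pos [simp]: "0 < 1 + hsq x"
  by (simp add: add_pos_nonneg)

lemma one_plus_hsq_neq_0 [simp]: "1 + hsq x \<noteq> 0"
  using one_plus_hsq_pos[of x] by linarith

lemma continuous_on_hsq [continuous_intros]: "continuous_on S hsq"
  unfolding hsq_def by (intro continuous_intros)

lemma continuous_on_hdiv [continuous_intros]: "continuous_on S hdiv"
  unfolding hdiv_def by (intro continuous_intros) auto

lemma hsq_add_axis_last: "hsq (x + s *\<^sub>R axis last_index 1) = hsq x"
  by (auto simp: hsq_def axis_def intro!: sum.cong)

lemma hsq_add_axis:
  assumes "i \<noteq> last_index"
  shows "hsq (x + s *\<^sub>R axis i 1) = hsq x + 2 * s * x $ i + s\<^sup>2"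
proof -
  have *: "i \<in> UNIV - {last_index}" using assms by auto
  have "(\<Sum>j\<in>UNIV - {last_index} - {i}. ((x + s *\<^sub>R axis i 1) $ j)\<^sup>2) =
        (\<Sum>j\<in>UNIV - {last_index} - {i}. (x $ j)\<^sup>2)"
    by (auto simp: axis_def intro!: sum.cong)
  then show ?thesis
    by (simp add: hsq_def sum.remove[OF _ *] axis_def power2_eq_square algebra_simps)
qed

text \<open>The subtracted term of \<open>hdiv\<close> is at most \<open>2 / (1 + hsq x)\<close>,
  which leaves at least (n - 3) / (1 + |y|^2); this is where n \<ge> 4 enters. Dropping that term
  gives the upper bound.\<close>

lemma hdiv_bounds:
  fixes x :: "real ^ 'n::{finite,linorder}"
  assumes "CARD('n) \<ge> 4"
  shows "1 / (1 + hsq x) \<le> hdiv x" "hdiv x \<le> real CARD('n)"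
proof -
  let ?N = "real CARD('n)" and ?q = "hsq x"
  have N: "?N \<ge> 4" using assms by simp
  have "2 * ?q / (1 + ?q)\<^sup>2 \<le> 2 / (1 + ?q)"
    by (simp add: power2_eq_square divide_simps)
  moreover have "3 / (1 + ?q) \<le> (?N - 1) / (1 + ?q)"
    using N by (intro divide_right_mono) auto
  moreover have "3 / (1 + ?q) = 1 / (1 + ?q) + 2 / (1 + ?q)"
    by (simp add: divide_simps)
  ultimately show "1 / (1 + ?q) \<le> hdiv x"
    unfolding hdiv_def by linarith
  have "hdiv x \<le> (?N - 1) / (1 + ?q)"
    by (simp add: hdiv_def)
  also have "\<dots> \<le> (?N - 1) / 1"
    using N by (intro divide_left_mono) auto
  finally show "hdiv x \<le> ?N"
    by simp
qed

lemma continuous_on_counterexample_field: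
  "continuous_on UNIV (\<lambda>x. counterexample_field \<epsilon> x $ i)"
  by (cases "i = last_index")
    (auto simp: counterexample_field_def intro!: continuous_intros
      continuous_on_compose2[OF continuous_on_ramp] continuous_on_compose2[OF continuous_on_ramp'])

lemma continuous_on_counterexample_partial:
  "continuous_on UNIV (counterexample_partial \<epsilon> i)"
  unfolding counterexample_partial_def
  by (cases "i = last_index")
    (auto intro!: continuous_intros
      continuous_on_compose2[OF continuous_on_ramp] continuous_on_compose2[OF continuous_on_ramp'])

text \<open>Along its own axis each component varies through a single factor: \<open>hsq\<close>
  ignores a shift of the last coordinate, and \<open>ramp'\<close> ignores a horizontal shift. So
  \<open>ramp'\<close>, which has a corner at 0, is never differentiated.\<close>

lemma has_derivative_counterexample_field:
  "((\<lambda>s. counterexample_field \<epsilon> (x + s *\<^sub>R axis i 1) $ i)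
     has_real_derivative counterexample_partial \<epsilon> i x) (at 0)"
proof (cases "i = last_index")
  case True
  have "((\<lambda>s. ramp (x $ last_index + s)) has_real_derivative ramp' (x $ last_index)) (at 0)"
    using has_real_derivative_ramp[of "x $ last_index + 0"]
      DERIV_shift[of ramp _ 0 "x $ last_index"] by (simp add: add.commute)
  from DERIV_cmult[OF DERIV_cmult_right[OF this, of "hdiv x"], of \<epsilon>] show ?thesis
    using True
    by (simp add: counterexample_field_def counterexample_partial_def hdiv_def
        hsq_add_axis_last mult.commute)
next
  case False
  let ?q = "hsq x"
  have "((\<lambda>s. (x $ i + s) / (1 + (?q + 2 * s * x $ i + s\<^sup>2))) has_real_derivative
      ((1 + ?q) - x $ i * (2 * x $ i)) / ((1 + ?q) * (1 + ?q))) (at 0)"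
    by (auto intro!: derivative_eq_intros)
  also have "((1 + ?q) - x $ i * (2 * x $ i)) / ((1 + ?q) * (1 + ?q)) =
      1 / (1 + ?q) - 2 * (x $ i)\<^sup>2 / (1 + ?q)\<^sup>2"
    by (simp add: power2_eq_square diff_divide_distrib)
  finally have "((\<lambda>s. - (\<epsilon> * ramp' (x $ last_index)) *
      ((x $ i + s) / (1 + (?q + 2 * s * x $ i + s\<^sup>2)))) has_real_derivative
      - (\<epsilon> * ramp' (x $ last_index)) *
      (1 / (1 + ?q) - 2 * (x $ i)\<^sup>2 / (1 + ?q)\<^sup>2)) (at 0)"
    by (rule DERIV_cmult)
  moreover have "axis i (1::real) $ i = 1" "axis i (1::real) $ last_index = 0"
    using False by (auto simp: axis_def)
  ultimately show ?thesis
    using False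
    by (simp add: counterexample_field_def counterexample_partial_def hsq_add_axis mult.assoc)
qed

text \<open>The horizontal entries add up to -\<epsilon> g' div A, which cancels the vertical
  entry.\<close>

lemma sum_counterexample_partial: "(\<Sum>i\<in>UNIV. counterexample_partial \<epsilon> i x) = 0"
proof -
  let ?p = "ramp' (x $ last_index)" and ?U = "UNIV - {last_index} :: 'a set"
  have "(\<Sum>i\<in>?U. counterexample_partial \<epsilon> i x) =
        (\<Sum>i\<in>?U. - (\<epsilon> * ?p) * (1 / (1 + hsq x) - 2 / (1 + hsq x)\<^sup>2 * (x $ i)\<^sup>2))"
    by (auto simp: counterexample_partial_def intro!: sum.cong)
  also have "\<dots> = - (\<epsilon> * ?p) *
      ((\<Sum>i\<in>?U. 1 / (1 + hsq x)) - 2 / (1 + hsq x)\<^sup>2 * (\<Sum>i\<in>?U. (x $ i)\<^sup>2))"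
    by (simp only: sum_subtractf flip: sum_distrib_left)
  also have "(\<Sum>i\<in>?U. (x $ i)\<^sup>2) = hsq x"
    by (simp add: hsq_def)
  also have "(\<Sum>i\<in>?U. 1 / (1 + hsq x)) = (real CARD('a) - 1) / (1 + hsq x)"
    by (simp add: card_Diff_singleton of_nat_diff Suc_leI)
  also have "- (\<epsilon> * ?p) * ((real CARD('a) - 1) / (1 + hsq x) - 2 / (1 + hsq x)\<^sup>2 * hsq x)
      = - counterexample_partial \<epsilon> last_index x"
    by (simp add: counterexample_partial_def hdiv_def)
  finally show ?thesis
    by (simp add: sum.remove[of UNIV last_index])
qed

text \<open>The horizontal components contribute the 4, through g'^2 \<le> 4 g and |A|^2 \<le> div
  A. The vertical one contributes n, through g \<le> 1 and div A \<le> n.\<close>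

lemma counterexample_field_norm_le:
  fixes x :: "real ^ 'n::{finite,linorder}"
  assumes N: "CARD('n) \<ge> 4"
  shows "(norm (counterexample_field \<epsilon> x))\<^sup>2
    \<le> \<epsilon> * (real CARD('n) + 4) * counterexample_field \<epsilon> x $ last_index"
proof -
  let ?p = "ramp' (x $ last_index)" and ?g = "ramp (x $ last_index)"
  have D: "1 / (1 + hsq x) \<le> hdiv x" "hdiv x \<le> real CARD('n)"
    using hdiv_bounds[OF N] by auto
  have D0: "hdiv x \<ge> 0"
    using D(1) by (meson divide_nonneg_pos one_plus_hsq_pos order_trans zero_le_one)
  have "(norm (counterexample_field \<epsilon> x))\<^sup>2 = (\<Sum>i\<in>UNIV. (counterexample_field \<epsilon> x $ i)\<^sup>2)"
    by (simp add: norm_vec_def L2_set_def sum_nonneg)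
  also have "\<dots> = (counterexample_field \<epsilon> x $ last_index)\<^sup>2 +
      (\<Sum>i\<in>UNIV - {last_index}. (counterexample_field \<epsilon> x $ i)\<^sup>2)"
    by (simp add: sum.remove[of UNIV last_index])
  also have "(\<Sum>i\<in>UNIV - {last_index}. (counterexample_field \<epsilon> x $ i)\<^sup>2) =
      (\<Sum>i\<in>UNIV - {last_index}. \<epsilon>\<^sup>2 * (?p\<^sup>2 / (1 + hsq x)\<^sup>2) * (x $ i)\<^sup>2)"
    by (auto simp: counterexample_field_def power_mult_distrib power_divide intro!: sum.cong)
  also have "\<dots> = \<epsilon>\<^sup>2 * (?p\<^sup>2 / (1 + hsq x)\<^sup>2) * hsq x"
    by (simp only: hsq_def flip: sum_distrib_left)
  also have "\<dots> = \<epsilon>\<^sup>2 * (?p\<^sup>2 * (hsq x / (1 + hsq x)\<^sup>2))"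
    by simp
  also have "\<dots> \<le> \<epsilon>\<^sup>2 * ((4 * ?g) * hdiv x)"
  proof -
    \<comment> \<open>The left-hand side is |A|^2.\<close>
    have "hsq x / (1 + hsq x)\<^sup>2 \<le> 1 / (1 + hsq x)"
      by (simp add: power2_eq_square divide_simps)
    with D have "hsq x / (1 + hsq x)\<^sup>2 \<le> hdiv x"
      by linarith
    then show ?thesis
      using ramp'_square_le ramp_bounds by (intro mult_left_mono mult_mono) auto
  qed
  also have "(counterexample_field \<epsilon> x $ last_index)\<^sup>2 = \<epsilon>\<^sup>2 * ((?g * hdiv x) * (?g * hdiv x))"
    by (simp add: counterexample_field_def power2_eq_square)
  also have "\<dots> \<le> \<epsilon>\<^sup>2 * (real CARD('n) * (?g * hdiv x))"
  proof -
    have "?g * hdiv x \<le> 1 * real CARD('n)"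
      using ramp_bounds D D0 by (intro mult_mono) auto
    then show ?thesis
      using ramp_bounds D0 by (intro mult_left_mono mult_right_mono) auto
  qed
  finally show ?thesis
    by (simp add: counterexample_field_def power2_eq_square algebra_simps)
qed

section \<open>Vanishing distributional divergence\<close>

lemma test_functionD:
  fixes \<psi> :: "real ^ 'n::finite \<Rightarrow> real"
  assumes "test_function \<psi>"
  shows "continuous_on UNIV \<psi>" "continuous_on UNIV (partial_deriv i \<psi>)"
    and "((\<lambda>s. \<psi> (x + s *\<^sub>R axis i 1)) has_real_derivative partial_deriv i \<psi> x) (at 0)"
    and "\<exists>R. \<forall>x. norm x > R \<longrightarrow> \<psi> x = 0"
proof -
  have C: "Ck 0 \<psi>" "Ck (Suc 0) \<psi>" and K: "compact (closure {x. \<psi> x \<noteq> 0})"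
    using assms unfolding test_function_def by blast+
  show "continuous_on UNIV \<psi>" "continuous_on UNIV (partial_deriv i \<psi>)"
    using C by auto
  have "(\<psi> has_derivative frechet_derivative \<psi> (at x)) (at x)"
    using C(2) frechet_derivative_works by auto
  \<comment> \<open>The base point is written as the value at \<open>s = 0\<close> of the line
    \<open>x + s *\<^sub>R axis i 1\<close>, the form that the chain rule expects.\<close>
  then have d: "(\<psi> has_derivative frechet_derivative \<psi> (at x)) (at (x + 0 *\<^sub>R axis i 1))"
    by simp
  have lin: "linear (frechet_derivative \<psi> (at x))"
    using C(2) linear_frechet_derivative by auto
  have "((\<lambda>s. x + s *\<^sub>R axis i 1) has_derivative (\<lambda>s. s *\<^sub>R axis i 1)) (at (0::real))"
    by (auto intro!: derivative_eq_intros)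
  from has_derivative_compose[OF this d]
  have "((\<lambda>s. \<psi> (x + s *\<^sub>R axis i 1)) has_derivative (\<lambda>s. partial_deriv i \<psi> x * s)) (at 0)"
    by (simp add: partial_deriv_def linear_scale[OF lin] mult.commute[of "frechet_derivative _ _ _"])
  then show "((\<lambda>s. \<psi> (x + s *\<^sub>R axis i 1)) has_real_derivative partial_deriv i \<psi> x) (at 0)"
    by (simp add: has_field_derivative_def)
  have "bounded {x. \<psi> x \<noteq> 0}"
    using bounded_subset[OF compact_imp_bounded[OF K] closure_subset] .
  then show "\<exists>R. \<forall>x. norm x > R \<longrightarrow> \<psi> x = 0"
    unfolding bounded_iff by (metis (mono_tags, lifting) mem_Collect_eq not_less)
qed

text \<open>Integration by parts, one direction at a time: \<open>?F i\<close> is the i-th partial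
  derivative of the compactly supported product of \<psi> and the i-th component, so its integral is
  0. Summing over i leaves the pairing with the gradient of \<psi>.\<close>

lemma distributional_div_zero_counterexample_field:
  "distributional_div_zero (counterexample_field \<epsilon>)"
  unfolding distributional_div_zero_def
proof (intro allI impI)
  fix \<psi> :: "real ^ 'a::{finite,linorder} \<Rightarrow> real"
  assume \<psi>: "test_function \<psi>"
  let ?\<eta> = "counterexample_field \<epsilon> :: real ^ 'a::{finite,linorder} \<Rightarrow> real ^ 'a::{finite,linorder}"
  let ?F = "\<lambda>i x. counterexample_partial \<epsilon> i x * \<psi> x + ?\<eta> x $ i * partial_deriv i \<psi> x"
  obtain R where R: "\<And>x. norm x > R \<Longrightarrow> \<psi> x = 0"
    using test_functionD(4)[OF \<psi>] by blast
  have "has_bochner_integral lborel (?F i) 0" for i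
  proof (rule has_bochner_integral_directional_derivative_zero)
    show "continuous_on UNIV (\<lambda>x. ?\<eta> x $ i * \<psi> x)" "continuous_on UNIV (?F i)"
      by (intro continuous_intros continuous_on_counterexample_field
          continuous_on_counterexample_partial test_functionD[OF \<psi>])+
    show "((\<lambda>s. ?\<eta> (x + s *\<^sub>R axis i 1) $ i * \<psi> (x + s *\<^sub>R axis i 1))
        has_real_derivative ?F i x) (at 0)" for x
      using DERIV_mult[OF has_derivative_counterexample_field[of \<epsilon> x i] test_functionD(3)[OF \<psi>, of x i]]
      by (simp add: algebra_simps)
    show "?\<eta> x $ i * \<psi> x = 0" if "norm x > R" for x
      using R[OF that] by simp
  qed
  then have "has_bochner_integral lborel (\<lambda>x. \<Sum>i\<in>UNIV. ?F i x) (\<Sum>i\<in>(UNIV::'a set). 0)"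
    by (intro has_bochner_integral_sum) auto
  \<comment> \<open>The terms containing \<psi> undifferentiated cancel, as the diagonal entries sum
    to 0 pointwise.\<close>
  also have "(\<lambda>x. \<Sum>i\<in>UNIV. ?F i x) = (\<lambda>x. \<Sum>i\<in>UNIV. ?\<eta> x $ i * partial_deriv i \<psi> x)"
    by (simp add: sum.distrib sum_counterexample_partial flip: sum_distrib_right)
  finally show "has_bochner_integral lebesgue (\<lambda>x. \<Sum>i\<in>UNIV. ?\<eta> x $ i * partial_deriv i \<psi> x) 0"
    by (auto simp: has_bochner_integral_iff integrable_completion integral_completion)
qed

section \<open>Failure of quadratic rigidity for every constant\<close>

theorem theorem4p2:
  fixes c :: real
  assumes "CARD('n::{finite,linorder}) \<ge> 4" and "c > 0"
  shows "\<not> phi_rigidity TYPE('n) (\<lambda>t. c * t\<^sup>2)"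
proof
  assume rigid: "phi_rigidity TYPE('n) (\<lambda>t. c * t\<^sup>2)"
  \<comment> \<open>Chosen so that c times the constant in
    \<open>counterexample_field_norm_le\<close> is exactly 1.\<close>
  define \<epsilon> where "\<epsilon> = 1 / (c * (real CARD('n) + 4))"
  have \<epsilon>: "\<epsilon> > 0" "c * (\<epsilon> * (real CARD('n) + 4)) = 1"
    using assms(2) by (auto simp: \<epsilon>_def add_nonneg_pos)
  let ?\<eta> = "counterexample_field \<epsilon> :: real ^ 'n::{finite,linorder} \<Rightarrow> real ^ 'n::{finite,linorder}"
  have quad: "c * (norm (?\<eta> x))\<^sup>2 \<le> ?\<eta> x $ last_index" for x
  proof -
    have "c * (norm (?\<eta> x))\<^sup>2 \<le> c * (\<epsilon> * (real CARD('n) + 4) * ?\<eta> x $ last_index)"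
      using counterexample_field_norm_le[OF assms(1)] assms(2) by (intro mult_left_mono) auto
    also have "\<dots> = c * (\<epsilon> * (real CARD('n) + 4)) * ?\<eta> x $ last_index"
      by simp
    finally show ?thesis
      by (simp only: \<epsilon>(2) mult_1)
  qed
  \<comment> \<open>Boundedness comes from the quadratic condition itself: c |\<eta>|^2 \<le>
    \<eta>_n \<le> |\<eta>|.\<close>
  have bound: "norm (?\<eta> x) \<le> 1 / c" for x
  proof -
    have "c * (norm (?\<eta> x))\<^sup>2 \<le> norm (?\<eta> x)"
      using quad[of x] component_le_norm_cart[of "?\<eta> x" last_index] by linarith
    then have "norm (?\<eta> x) * (c * norm (?\<eta> x)) \<le> norm (?\<eta> x) * 1"
      by (simp add: power2_eq_square ac_simps)
    then have "norm (?\<eta> x) = 0 \<or> c * norm (?\<eta> x) \<le> 1"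
      by (metis mult_le_cancel_left_pos norm_ge_zero order_le_less)
    then show ?thesis
      using assms(2) by (auto simp: pos_le_divide_eq mult.commute)
  qed
  have "continuous_on UNIV (\<lambda>x. \<chi> i. ?\<eta> x $ i)"
    by (intro continuous_on_vec_lambda continuous_on_counterexample_field)
  then have "?\<eta> \<in> borel_measurable lborel"
    by (simp add: borel_measurable_continuous_onI)
  then have "?\<eta> \<in> borel_measurable lebesgue"
    by (rule measurable_completion)
  then have "L_infinity ?\<eta>"
    using bound unfolding L_infinity_def by blast
  moreover have "?\<eta> x = 0" if "x $ last_index < 0" for x
    using that by (simp add: vec_eq_iff counterexample_field_def ramp_def ramp'_def)
  ultimately have "AE x in lebesgue. ?\<eta> x = 0"
    using rigid quad distributional_div_zero_counterexample_field
    unfolding phi_rigidity_def by blast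
  moreover have "?\<eta> x \<noteq> 0" if "x $ last_index > 0" for x
  proof -
    have "hdiv x > 0"
      using hdiv_bounds(1)[OF assms(1), of x] by (rule less_le_trans[rotated]) simp
    then have "?\<eta> x $ last_index > 0"
      using that \<epsilon>(1) by (simp add: counterexample_field_def ramp_pos)
    then show ?thesis
      by auto
  qed
  \<comment> \<open>The field vanishes nowhere on the upper half-space, so rigidity would make this
    nonempty open set a null set.\<close>
  ultimately have "AE x in lebesgue. \<not> x $ (last_index :: 'n::{finite,linorder}) > (0::real)"
    by (auto elim: eventually_mono)
  then have "negligible {x :: real ^ 'n::{finite,linorder}. x $ last_index > 0}"
    by (simp add: AE_iff_null_sets negligible_iff_null_sets)
  moreover have "open {x :: real ^ 'n::{finite,linorder}. x $ last_index > 0}"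
    by (intro open_Collect_less continuous_intros)
  moreover have "axis last_index 1 \<in> {x :: real ^ 'n::{finite,linorder}. x $ last_index > 0}"
    by simp
  ultimately show False
    using open_not_negligible by blast
qed

end
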